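(* Fix $\rho>1$. Then for all sufficiently small $\epsilon>0$ (depending on $\rho$), the set $\Sigma_\epsilon\cap\{(x,y,z):y\ge1,\ \rho^{-1}\le r\le\rho\}$ is parametrised as a horizontal graph $y=g_\epsilon(x,z)$, and in the polar coordinates $x=r\sin\gamma$, $z=r\cos\gamma$ the graphing function admits the expansion $$g_\epsilon(r,\gamma)=1-\epsilon\log\epsilon+\epsilon\log(2r)+\mathcal O_\rho(\epsilon^2(\log\epsilon)^2)\quad\text{as }\epsilon\to0,$$ where the implied constant depends only on $\rho$.
   Context: Use the model $\{(x,y,z):y>0\}$ of $\mathbb H^2\times\mathbb R$ with metric $\frac{dx^2+dy^2}{y^2}+dz^2$. For $\alpha>0$ put $\alpha_*=\sqrt{\alpha^2+1}$ and $\epsilon=\frac{\alpha_*}{\alpha}-1$; $\alpha$ and $\epsilon$ are equivalent parameters ($\epsilon\to0$ iff $\alpha\to\infty$). For $\theta\in\mathbb S^1=\mathbb R/2\pi\mathbb Z$ let $\varphi'=\varphi'(\theta)=-\sqrt{\alpha^2+\cos^2\theta}$, and $$\omega(s,\theta)=\Big(1+\frac{\sin^2\theta}{\alpha_*(\alpha+\alpha_* )(\alpha-\varphi')(\alpha_*-\varphi')}e^{-s}\cosh s\Big)^{-1},$$ $$\mathbf X_\alpha(s,\theta)=\Big(\frac{\sin\theta}{\alpha_*(\alpha-\varphi')}(\cosh s)e^{\epsilon s}\omega,\ e^{\epsilon s}\omega,\ \frac{\cos\theta}{\alpha(\alpha-\varphi')}\cosh s\Big),\quad (s,\theta)\in\mathbb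 R\times\mathbb S^1 .$$ $\Sigma_\epsilon=\mathbf X_\alpha(\mathbb R\times\mathbb S^1)$ is the horizontal catenoid of parameter $\epsilon$. Here $r=\sqrt{x^2+z^2}$. *)

theory Defs
  imports Complex_Main
begin

text \<open>
  Points of \<open>\<H>\<^sup>2 \<times> \<real>\<close> in the half-space model are triples \<open>(x, y, z)\<close> with \<open>y > 0\<close>.
  An angle in \<open>\<real>/2\<pi>\<int>\<close> is represented by any real number; every formula below
  is \<open>2\<pi>\<close>-periodic in \<open>\<theta>\<close>.
\<close>

definition alpha_star :: "real \<Rightarrow> real" where
  "alpha_star \<alpha> = sqrt (\<alpha>\<^sup>2 + 1)"

definition eps_of_alpha :: "real \<Rightarrow> real" where
  "eps_of_alpha \<alpha> = alpha_star \<alpha> / \<alpha> - 1"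

definition phi' :: "real \<Rightarrow> real \<Rightarrow> real" where
  "phi' \<alpha> \<theta> = - sqrt (\<alpha>\<^sup>2 + (cos \<theta>)\<^sup>2)"

definition omega :: "real \<Rightarrow> real \<Rightarrow> real \<Rightarrow> real" where
  "omega \<alpha> s \<theta> =
     inverse (1 + (sin \<theta>)\<^sup>2
       / (alpha_star \<alpha> * (\<alpha> + alpha_star \<alpha>) * (\<alpha> - phi' \<alpha> \<theta>) * (alpha_star \<alpha> - phi' \<alpha> \<theta>))
       * exp (- s) * cosh s)"

definition catenoid_param :: "real \<Rightarrow> real \<times> real \<Rightarrow> real \<times> real \<times> real" where
  "catenoid_param \<alpha> = (\<lambda>(s, \<theta>).
     (sin \<theta> / (alpha_star \<alpha> * (\<alpha> - phi' \<alpha> \<theta>)) * cosh s * exp (eps_of_alpha \<alpha> * s) * omega \<alpha> s \<theta>,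
      exp (eps_of_alpha \<alpha> * s) * omega \<alpha> s \<theta>,
      cos \<theta> / (\<alpha> * (\<alpha> - phi' \<alpha> \<theta>)) * cosh s))"

lemma catenoid_param_periodic:
  "catenoid_param \<alpha> (s, \<theta> + 2 * pi) = catenoid_param \<alpha> (s, \<theta>)"
  by (simp add: catenoid_param_def omega_def phi'_def)

definition alpha_of_eps :: "real \<Rightarrow> real" where
  "alpha_of_eps \<epsilon> = (THE \<alpha>. \<alpha> > 0 \<and> eps_of_alpha \<alpha> = \<epsilon>)"

lemma eps_of_alpha_eq_iff:
  assumes "\<alpha> > 0" "\<epsilon> > 0"
  shows "eps_of_alpha \<alpha> = \<epsilon> \<longleftrightarrow> \<alpha> = 1 / sqrt (\<epsilon> * (\<epsilon> + 2))"
proof -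
  have "eps_of_alpha \<alpha> = \<epsilon> \<longleftrightarrow> sqrt (\<alpha>\<^sup>2 + 1) = (1 + \<epsilon>) * \<alpha>"
    using assms by (auto simp: eps_of_alpha_def alpha_star_def field_simps)
  also have "\<dots> \<longleftrightarrow> \<alpha>\<^sup>2 + 1 = ((1 + \<epsilon>) * \<alpha>)\<^sup>2"
    using assms by (metis add_nonneg_nonneg less_eq_real_def mult_nonneg_nonneg real_sqrt_pow2
        real_sqrt_unique zero_le_one zero_le_power2)
  also have "\<dots> \<longleftrightarrow> \<alpha>\<^sup>2 * (\<epsilon> * (\<epsilon> + 2)) = 1"
    by (auto simp: algebra_simps power2_eq_square)
  also have "\<dots> \<longleftrightarrow> \<alpha>\<^sup>2 = 1 / (\<epsilon> * (\<epsilon> + 2))"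
    using assms by (subst nonzero_eq_divide_eq) auto
  also have "\<dots> \<longleftrightarrow> \<alpha> = sqrt (1 / (\<epsilon> * (\<epsilon> + 2)))"
    using assms by (smt (verit) real_sqrt_abs real_sqrt_pow2 zero_le_divide_1_iff mult_nonneg_nonneg)
  finally show ?thesis by (simp add: real_sqrt_divide)
qed

lemma alpha_of_eps_eq:
  assumes "\<epsilon> > 0"
  shows "alpha_of_eps \<epsilon> = 1 / sqrt (\<epsilon> * (\<epsilon> + 2))"
  unfolding alpha_of_eps_def
proof (rule the_equality)
  show "1 / sqrt (\<epsilon> * (\<epsilon> + 2)) > 0 \<and> eps_of_alpha (1 / sqrt (\<epsilon> * (\<epsilon> + 2))) = \<epsilon>"
    using assms by (subst eps_of_alpha_eq_iff) auto
qed (use assms eps_of_alpha_eq_iff in blast)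

definition horizontal_catenoid :: "real \<Rightarrow> (real \<times> real \<times> real) set" where
  "horizontal_catenoid \<epsilon> = range (catenoid_param (alpha_of_eps \<epsilon>))"

end

theory Submission
  imports Defs
begin

text \<open>
  Write \<open>u = -\<phi>'\<close> and \<open>\<omega> = 1 / (1 + \<delta>)\<close>. The point with parameters \<open>(s, \<theta>)\<close> is then
  \<open>x = sin \<theta> / (\<alpha>\<^sub>* (\<alpha> + u)) cosh s \<cdot> y\<close>, \<open>y = e\<^bsup>\<epsilon>s\<^esup> / (1 + \<delta>)\<close>,
  \<open>z = cos \<theta> / (\<alpha> (\<alpha> + u)) cosh s\<close>, with \<open>\<delta> \<ge> 0\<close>. Hence \<open>y \<ge> 1\<close> forces \<open>s \<ge> 0\<close>, and there
  \<open>\<delta> = O(\<epsilon>\<^sup>2)\<close>.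

  Expansion (\<open>height_expansion\<close>). The parameters satisfy \<open>\<alpha>\<^sup>2 \<epsilon> (\<epsilon> + 2) = 1\<close>, so
  \<open>\<alpha> \<le> u \<le> \<alpha>\<^sub>* = (1 + \<epsilon>) \<alpha>\<close> puts both coefficients \<open>1 / (\<alpha>\<^sub>* (\<alpha> + u))\<close> and
  \<open>1 / (\<alpha> (\<alpha> + u))\<close> at \<open>\<epsilon> (1 + O(\<epsilon>))\<close>. Therefore \<open>r = \<epsilon> cosh s\<close> up to factors between
  \<open>1 - O(\<epsilon>)\<close> and \<open>e\<^bsup>\<epsilon>s\<^esup> (1 + O(\<epsilon>))\<close> (\<open>radius_bounds\<close>). Inverting the hyperbolic cosine gives
  \<open>s = log (2r / \<epsilon>) + O(\<epsilon> log (1 / \<epsilon>))\<close>, and expanding \<open>y = e\<^bsup>\<epsilon>s\<^esup> (1 + O(\<epsilon>\<^sup>2))\<close> to first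
  order in \<open>\<epsilon>s\<close> yields \<open>y = 1 + \<epsilon> log (2r / \<epsilon>) + O(\<epsilon>\<^sup>2 (log \<epsilon>)\<^sup>2)\<close>.

  Graph. Both halves rest on eliminating \<open>\<theta>\<close> with the help of \<open>z\<close>: for fixed \<open>z\<close> and \<open>s\<close> the
  value of \<open>cos \<theta>\<close> is determined, and as \<open>s\<close> grows with \<open>z\<close> fixed, \<open>\<bar>cos \<theta>\<bar>\<close> does not
  grow and \<open>\<bar>x\<bar>\<close> strictly increases. Monotonicity shows that two points over the same \<open>(x, z)\<close> with
  \<open>s \<ge> 0\<close> have the same \<open>s\<close> and the same height (\<open>height_determined\<close>). Existence of a
  point over \<open>(x, z)\<close> is the intermediate value theorem for \<open>\<bar>x\<bar>\<close> as a function of \<open>s\<close> along the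
  curve of constant \<open>z\<close> (\<open>exists_param\<close>). Its height is at least \<open>1\<close> because
  \<open>r \<ge> \<rho>\<^sup>-\<^sup>1\<close> keeps \<open>s\<close> away from \<open>0\<close> (\<open>height_ge_1\<close>), so that \<open>e\<^bsup>\<epsilon>s\<^esup>\<close> beats \<open>1 + \<delta>\<close>.
\<close>

section \<open>The coefficients of the parametrisation\<close>

text \<open>With \<open>c = cos \<theta>\<close> this is \<open>-\<phi>'(\<theta>)\<close>. It is a function of \<open>c\<close> because \<open>c\<close> rather than the
  angle is the natural unknown on the curves of constant \<open>z\<close>.\<close>
abbreviation (input) speed :: "real \<Rightarrow> real \<Rightarrow> real" where
  "speed \<alpha> c \<equiv> sqrt (\<alpha>\<^sup>2 + c\<^sup>2)"

lemma speed_ge: "\<alpha> > 0 \<Longrightarrow> \<alpha> \<le> speed \<alpha> c"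
  by (rule real_le_rsqrt) simp

lemma speed_cos_le_alpha_star: "speed \<alpha> (cos \<theta>) \<le> alpha_star \<alpha>"
  by (simp add: alpha_star_def abs_square_le_1)

lemma alpha_less_alpha_star: "\<alpha> > 0 \<Longrightarrow> \<alpha> < alpha_star \<alpha>"
  unfolding alpha_star_def by (rule real_less_rsqrt) simp

lemma alpha_star_sq: "(alpha_star \<alpha>)\<^sup>2 = \<alpha>\<^sup>2 + 1"
  by (simp add: alpha_star_def)

text \<open>The number \<open>\<delta>\<close> with \<open>\<omega> = 1 / (1 + \<delta>)\<close>.\<close>
definition omega_excess :: "real \<Rightarrow> real \<Rightarrow> real \<Rightarrow> real" where
  "omega_excess \<alpha> s \<theta> = (sin \<theta>)\<^sup>2 / (alpha_star \<alpha> * (\<alpha> + alpha_star \<alpha>)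
     * (\<alpha> + speed \<alpha> (cos \<theta>)) * (alpha_star \<alpha> + speed \<alpha> (cos \<theta>))) * (exp (- s) * cosh s)"

lemma omega_eq: "omega \<alpha> s \<theta> = 1 / (1 + omega_excess \<alpha> s \<theta>)"
  by (simp add: omega_def omega_excess_def phi'_def inverse_eq_divide mult.assoc)

lemma omega_excess_nonneg:
  assumes "\<alpha> > 0"
  shows "0 \<le> omega_excess \<alpha> s \<theta>"
proof -
  have "0 < alpha_star \<alpha>" "0 < speed \<alpha> (cos \<theta>)"
    using speed_ge[OF assms, of "cos \<theta>"] alpha_less_alpha_star[OF assms] assms by linarith+
  then show ?thesis using assms unfolding omega_excess_def
    by (intro mult_nonneg_nonneg divide_nonneg_nonneg) auto
qed

lemma exp_minus_cosh_le_1: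
  assumes "0 \<le> (s::real)"
  shows "exp (- s) * cosh s \<le> 1"
proof -
  have "exp (-s) \<le> exp s" using assms by simp
  then have "cosh s \<le> exp s" by (simp add: cosh_def)
  then have "exp (-s) * cosh s \<le> exp (-s) * exp s" by (intro mult_left_mono) auto
  then show ?thesis by (simp flip: exp_add)
qed

text \<open>Each of the four factors in the denominator is at least \<open>\<alpha>\<close> or \<open>2\<alpha>\<close>.\<close>
lemma omega_excess_le:
  assumes "\<alpha> > 0" "0 \<le> s"
  shows "omega_excess \<alpha> s \<theta> \<le> 1 / (8 * \<alpha> ^ 4)"
proof -
  define u where "u = speed \<alpha> (cos \<theta>)"
  have u: "\<alpha> \<le> u" using speed_ge[OF assms(1)] by (simp add: u_def)
  have st: "\<alpha> \<le> alpha_star \<alpha>" using alpha_less_alpha_star[OF assms(1)] by simp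
  have "\<alpha> * (2 * \<alpha>) * (2 * \<alpha>) * (2 * \<alpha>)
      \<le> alpha_star \<alpha> * (\<alpha> + alpha_star \<alpha>) * (\<alpha> + u) * (alpha_star \<alpha> + u)"
    using assms u st by (intro mult_mono mult_nonneg_nonneg add_nonneg_nonneg) linarith+
  then have "8 * \<alpha> ^ 4 \<le> alpha_star \<alpha> * (\<alpha> + alpha_star \<alpha>) * (\<alpha> + u) * (alpha_star \<alpha> + u)"
    by (simp add: power4_eq_xxxx mult_ac)
  moreover have "(sin \<theta>)\<^sup>2 \<le> 1" by (simp add: abs_square_le_1)
  ultimately have "(sin \<theta>)\<^sup>2 / (alpha_star \<alpha> * (\<alpha> + alpha_star \<alpha>) * (\<alpha> + u) * (alpha_star \<alpha> + u))
      \<le> 1 / (8 * \<alpha> ^ 4)"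
    using assms by (intro frac_le) auto
  then have "omega_excess \<alpha> s \<theta> \<le> 1 / (8 * \<alpha> ^ 4) * 1"
    unfolding omega_excess_def u_def using assms exp_minus_cosh_le_1[OF assms(2)]
    by (intro mult_mono) auto
  then show ?thesis by simp
qed

lemma eps_pos: "\<alpha> > 0 \<Longrightarrow> eps_of_alpha \<alpha> > 0"
  using alpha_less_alpha_star by (simp add: eps_of_alpha_def field_simps)

lemma alpha_star_eq: "\<alpha> > 0 \<Longrightarrow> alpha_star \<alpha> = (1 + eps_of_alpha \<alpha>) * \<alpha>"
  by (simp add: eps_of_alpha_def)

lemma catenoid_param_iff:
  "catenoid_param \<alpha> (s, \<theta>) = (x, y, z) \<longleftrightarrow>
     y = exp (eps_of_alpha \<alpha> * s) / (1 + omega_excess \<alpha> s \<theta>) \<and>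
     x = sin \<theta> / (alpha_star \<alpha> * (\<alpha> + speed \<alpha> (cos \<theta>))) * cosh s * y \<and>
     z = cos \<theta> / (\<alpha> * (\<alpha> + speed \<alpha> (cos \<theta>))) * cosh s"
  by (auto simp: catenoid_param_def omega_eq phi'_def)

lemma abs_z_eq:
  assumes "\<alpha> > 0" "catenoid_param \<alpha> (s, \<theta>) = (x, y, z)"
  shows "\<bar>z\<bar> * \<alpha> = \<bar>cos \<theta>\<bar> / (\<alpha> + speed \<alpha> \<bar>cos \<theta>\<bar>) * cosh s"
proof -
  have "0 < \<alpha> + speed \<alpha> (cos \<theta>)"
    using speed_ge[OF assms(1), of "cos \<theta>"] assms(1) by linarith
  then have "\<bar>z\<bar> = \<bar>cos \<theta>\<bar> / (\<alpha> * (\<alpha> + speed \<alpha> (cos \<theta>))) * cosh s"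
    using assms by (simp add: catenoid_param_iff abs_mult)
  then show ?thesis using assms(1) by simp
qed

text \<open>Since \<open>\<omega> \<le> 1\<close>, negative \<open>s\<close> puts the point below height \<open>1\<close>; the part of the catenoid in
  question is thus contained in the half \<open>s \<ge> 0\<close>.\<close>
lemma height_ge_1_imp_nonneg:
  assumes "\<alpha> > 0" "catenoid_param \<alpha> (s, \<theta>) = (x, y, z)" "1 \<le> y"
  shows "0 \<le> s"
proof (rule ccontr)
  assume "\<not> 0 \<le> s"
  then have "exp (eps_of_alpha \<alpha> * s) < 1"
    using eps_pos[OF assms(1)] by (simp add: mult_pos_neg)
  moreover have "1 + omega_excess \<alpha> s \<theta> \<le> exp (eps_of_alpha \<alpha> * s)"
    using assms(2,3) omega_excess_nonneg[OF assms(1), of s \<theta>]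
    by (simp add: catenoid_param_iff pos_le_divide_eq)
  ultimately show False using omega_excess_nonneg[OF assms(1), of s \<theta>] by linarith
qed

section \<open>At most one point over each \<open>(x, z)\<close>\<close>

text \<open>For fixed \<open>s\<close> the coordinate \<open>z\<close> is this function of \<open>cos \<theta>\<close>, up to a positive factor; its
  strict monotonicity lets \<open>z\<close> and \<open>s\<close> determine \<open>cos \<theta>\<close>.\<close>
lemma divide_speed_strict_mono:
  fixes c d :: real
  assumes "\<alpha> > 0" "0 \<le> c" "c < d"
  shows "c / (\<alpha> + speed \<alpha> c) < d / (\<alpha> + speed \<alpha> d)"
proof -
  have "c * speed \<alpha> d \<le> d * speed \<alpha> c"
  proof (rule power2_le_imp_le)
    have "c\<^sup>2 \<le> d\<^sup>2" using assms by (intro power_mono) auto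
    then have "c\<^sup>2 * \<alpha>\<^sup>2 \<le> d\<^sup>2 * \<alpha>\<^sup>2" by (intro mult_right_mono) auto
    then show "(c * speed \<alpha> d)\<^sup>2 \<le> (d * speed \<alpha> c)\<^sup>2"
      by (simp add: power_mult_distrib algebra_simps)
  qed (use assms in auto)
  moreover have "c * \<alpha> < d * \<alpha>" using assms by simp
  moreover have "0 < \<alpha> + speed \<alpha> c" "0 < \<alpha> + speed \<alpha> d"
    using assms speed_ge[OF assms(1)] by (smt (verit))+
  ultimately show ?thesis by (simp add: frac_less_eq divide_less_eq less_divide_eq algebra_simps)
qed

text \<open>The function \<open>a / k + b k\<close> decreases in \<open>k\<close> as long as \<open>b k\<^sup>2 \<le> a\<close>, so shrinking \<open>a\<close> and
  \<open>b\<close> while enlarging \<open>k\<close> decreases it. The product \<open>k1 * k2\<close> replaces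
  \<open>k\<^sup>2\<close> because \<open>a / k1 + b k1 - a / k2 - b k2 = (k2 - k1) (a / (k1 k2) - b)\<close>.\<close>
lemma recip_plus_linear_strict_decreasing:
  fixes a1 a2 b1 b2 k1 k2 :: real
  assumes "a2 < a1" "b2 \<le> b1" "0 < k1" "k1 \<le> k2" "b1 * (k1 * k2) \<le> a1"
  shows "a2 / k2 + b2 * k2 < a1 / k1 + b1 * k1"
proof -
  have "a2 / k2 + b2 * k2 < a1 / k2 + b1 * k2"
    using assms by (intro add_less_le_mono divide_strict_right_mono mult_right_mono) auto
  also have "\<dots> \<le> a1 / k1 + b1 * k1"
  proof -
    have "a1 / k1 + b1 * k1 - (a1 / k2 + b1 * k2) = (k2 - k1) * (a1 - b1 * (k1 * k2)) / (k1 * k2)"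
      using assms by (simp add: field_simps)
    also have "\<dots> \<ge> 0" using assms by (intro divide_nonneg_nonneg mult_nonneg_nonneg) auto
    finally show ?thesis by simp
  qed
  finally show ?thesis .
qed

text \<open>This form of \<open>\<bar>x\<bar>\<close> separates the monotone pieces: at constant \<open>z\<close>, as \<open>s\<close> grows, the
  numerator increases, and in the denominator \<open>a / k + b k\<close> the quantities \<open>a\<close> and \<open>b\<close> decrease
  while \<open>k = \<bar>sin \<theta>\<bar> / (\<alpha> + u)\<close> does not.\<close>
lemma abs_x_eq:
  assumes "\<alpha> > 0" "catenoid_param \<alpha> (s, \<theta>) = (x, y, z)" "sin \<theta> \<noteq> 0"
  defines "u \<equiv> speed \<alpha> (cos \<theta>)"
  defines "k \<equiv> \<bar>sin \<theta>\<bar> / (\<alpha> + u)"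
  shows "alpha_star \<alpha> * \<bar>x\<bar> = exp (eps_of_alpha \<alpha> * s) /
    (1 / cosh s / k + exp (- s) / (alpha_star \<alpha> * (\<alpha> + alpha_star \<alpha>))
        * ((\<alpha> + u) / (alpha_star \<alpha> + u)) * k)"
proof -
  define A where "A = alpha_star \<alpha>"
  define S where "S = \<bar>sin \<theta>\<bar>"
  define E where "E = exp (eps_of_alpha \<alpha> * s)"
  define e where "e = exp (- s)"
  define H where "H = cosh s"
  define B where "B = A * (\<alpha> + A) * (\<alpha> + u) * (A + u)"
  have pos: "0 < \<alpha>" "0 < u" "0 < A" "0 < S" "0 < E" "0 < e" "0 < H" "0 < \<alpha> + A"
      "0 < \<alpha> + u" "0 < A + u"
  proof -
    show "0 < u" "0 < \<alpha> + u" using assms(1) speed_ge[OF assms(1), of "cos \<theta>"] unfolding u_def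
      by linarith+
    then show "0 < A + u" using assms(1) alpha_less_alpha_star[OF assms(1)] by (simp add: A_def)
  qed (use assms(1,3) alpha_less_alpha_star[OF assms(1)] in
      \<open>auto simp: A_def S_def E_def e_def H_def\<close>)
  have B: "0 < B" using pos by (simp add: B_def)
  have "omega_excess \<alpha> s \<theta> = S\<^sup>2 / B * (e * H)"
    by (simp add: omega_excess_def B_def A_def u_def S_def e_def H_def)
  then have W: "1 + omega_excess \<alpha> s \<theta> = (B + S\<^sup>2 * e * H) / B"
    using B by (simp add: field_simps)
  have "\<bar>x\<bar> = S / (A * (\<alpha> + u)) * H * (E / (1 + omega_excess \<alpha> s \<theta>))"
    using assms(2) pos omega_excess_nonneg[OF assms(1), of s \<theta>]
    by (simp add: catenoid_param_iff abs_mult S_def A_def u_def H_def E_def)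
  then have "A * \<bar>x\<bar> = S * H * E * B / ((\<alpha> + u) * (B + S\<^sup>2 * e * H))"
    unfolding W using pos B by simp
  also have "\<dots> = E / ((\<alpha> + u) * (B + S\<^sup>2 * e * H) / (S * H * B))"
    using pos B by simp
  also have "(\<alpha> + u) * (B + S\<^sup>2 * e * H) / (S * H * B) =
      1 / H / (S / (\<alpha> + u)) + e / (A * (\<alpha> + A)) * ((\<alpha> + u) / (A + u)) * (S / (\<alpha> + u))"
  proof -
    have "p * (g * p * h + S\<^sup>2 * e * H) / (S * H * (g * p * h)) =
        1 / H / (S / p) + e / g * (p / h) * (S / p)" if "0 < p" "0 < g" "0 < h" for p g h
      using that pos by (simp add: field_simps power2_eq_square)
    from this[of "\<alpha> + u" "A * (\<alpha> + A)" "A + u"] show ?thesis using pos by (simp add: B_def)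
  qed
  finally show ?thesis by (simp add: A_def S_def E_def e_def H_def k_def)
qed

text \<open>At the larger value of \<open>s\<close> the factor \<open>cosh s\<close> in \<open>z\<close> is larger, so \<open>\<bar>cos \<theta>\<bar>\<close> is at
  most, and \<open>\<bar>sin \<theta>\<bar>\<close> at least, what it was; then \<open>\<bar>x\<bar>\<close> is strictly larger, unless it vanishes
  at both points, which fixes \<open>\<bar>cos \<theta>\<bar> = 1\<close> and makes \<open>\<bar>z\<bar>\<close> differ. The assumptions \<open>1 \<le> \<alpha>\<close> and
  \<open>0 \<le> s1\<close> give the smallness \<open>b k\<^sup>2 \<le> a\<close>.\<close>
lemma no_two_sheets:
  assumes \<alpha>: "1 \<le> \<alpha>" and s: "0 \<le> s1" "s1 < s2"
    and p1: "catenoid_param \<alpha> (s1, \<theta>1) = (x, y1, z)"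
    and p2: "catenoid_param \<alpha> (s2, \<theta>2) = (x, y2, z)"
  shows False
proof -
  have \<alpha>0: "0 < \<alpha>" using \<alpha> by simp
  define u1 where "u1 = speed \<alpha> (cos \<theta>1)"
  define u2 where "u2 = speed \<alpha> (cos \<theta>2)"
  have u: "\<alpha> \<le> u1" "\<alpha> \<le> u2"
    using speed_ge[OF \<alpha>0] by (simp_all add: u1_def u2_def)
  have cosh_less: "cosh s1 < cosh s2" using s by (simp add: cosh_real_strict_mono)
  have z: "\<bar>z\<bar> * \<alpha> = \<bar>cos \<theta>1\<bar> / (\<alpha> + u1) * cosh s1" "\<bar>z\<bar> * \<alpha> = \<bar>cos \<theta>2\<bar> / (\<alpha> + u2) * cosh s2"
    using abs_z_eq[OF \<alpha>0 p1] abs_z_eq[OF \<alpha>0 p2] by (simp_all add: u1_def u2_def)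
  have cos_le: "\<bar>cos \<theta>2\<bar> \<le> \<bar>cos \<theta>1\<bar>"
  proof (rule ccontr)
    assume "\<not> ?thesis"
    then have "\<bar>cos \<theta>1\<bar> / (\<alpha> + u1) < \<bar>cos \<theta>2\<bar> / (\<alpha> + u2)"
      using divide_speed_strict_mono[OF \<alpha>0, of "\<bar>cos \<theta>1\<bar>" "\<bar>cos \<theta>2\<bar>"] by (simp add: u1_def u2_def)
    then have "\<bar>cos \<theta>1\<bar> / (\<alpha> + u1) * cosh s1 < \<bar>cos \<theta>2\<bar> / (\<alpha> + u2) * cosh s2"
    proof (rule mult_strict_mono)
      have "0 \<le> \<bar>cos \<theta>1\<bar> / (\<alpha> + u1)" using u \<alpha>0 by simp
      then show "0 < \<bar>cos \<theta>2\<bar> / (\<alpha> + u2)"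
        using \<open>\<bar>cos \<theta>1\<bar> / (\<alpha> + u1) < \<bar>cos \<theta>2\<bar> / (\<alpha> + u2)\<close> by (rule le_less_trans)
    qed (use cosh_less in auto)
    then show False using z by simp
  qed
  then have c2: "(cos \<theta>2)\<^sup>2 \<le> (cos \<theta>1)\<^sup>2" by (simp add: abs_le_square_iff)
  then have u_le: "u2 \<le> u1" by (simp add: u1_def u2_def)
  have "(sin \<theta>1)\<^sup>2 \<le> (sin \<theta>2)\<^sup>2" using c2 by (simp add: sin_squared_eq)
  then have sin_le: "\<bar>sin \<theta>1\<bar> \<le> \<bar>sin \<theta>2\<bar>" by (simp add: abs_le_square_iff)
  show False
  proof (cases "sin \<theta>1 = 0")
    case True
    then have "x = 0" using p1 by (simp add: catenoid_param_iff)
    moreover have "0 < y2" using p2 omega_excess_nonneg[OF \<alpha>0, of s2 \<theta>2]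
      by (auto simp: catenoid_param_iff)
    ultimately have "sin \<theta>2 = 0"
      using p2 u \<alpha>0 alpha_less_alpha_star[OF \<alpha>0]
      unfolding catenoid_param_iff u2_def[symmetric] by auto
    then have "(cos \<theta>1)\<^sup>2 = 1" "(cos \<theta>2)\<^sup>2 = 1" using True by (simp_all add: cos_squared_eq)
    then have "\<bar>cos \<theta>1\<bar> = 1" "\<bar>cos \<theta>2\<bar> = 1"
      by (simp_all add: abs_square_eq_1)
    moreover have "u1 = u2" using \<open>(cos \<theta>1)\<^sup>2 = 1\<close> \<open>(cos \<theta>2)\<^sup>2 = 1\<close> by (simp only: u1_def u2_def)
    ultimately
    show False using z cosh_less u \<alpha>0 s by simp
  next
    case False
    define A where "A = alpha_star \<alpha>"
    define a1 where "a1 = 1 / cosh s1"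
    define a2 where "a2 = 1 / cosh s2"
    define k1 where "k1 = \<bar>sin \<theta>1\<bar> / (\<alpha> + u1)"
    define k2 where "k2 = \<bar>sin \<theta>2\<bar> / (\<alpha> + u2)"
    define b1 where "b1 = exp (- s1) / (A * (\<alpha> + A)) * ((\<alpha> + u1) / (A + u1))"
    define b2 where "b2 = exp (- s2) / (A * (\<alpha> + A)) * ((\<alpha> + u2) / (A + u2))"
    have A: "\<alpha> < A" using alpha_less_alpha_star[OF \<alpha>0] by (simp add: A_def)
    have s2: "sin \<theta>2 \<noteq> 0" using False sin_le by auto
    have k: "0 < k1" "k1 \<le> k2"
      using False sin_le u u_le \<alpha>0 by (auto simp: k1_def k2_def intro!: frac_le)
    have a: "0 < a2" "a2 < a1" unfolding a1_def a2_def using cosh_less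
      by (auto intro!: divide_strict_left_mono)
    have AA: "1 \<le> A * (\<alpha> + A)" using A \<alpha> mult_mono[of 1 A 1 "\<alpha> + A"] by simp
    \<comment> \<open>\<open>v \<mapsto> (\<alpha> + v) / (A + v)\<close> increases because \<open>\<alpha> < A\<close>\<close>
    have "(\<alpha> + u2) / (A + u2) \<le> (\<alpha> + u1) / (A + u1)"
    proof -
      have "(A - \<alpha>) * u2 \<le> (A - \<alpha>) * u1" using A u_le by (intro mult_left_mono) auto
      then show ?thesis using A u \<alpha>0 by (simp add: field_simps)
    qed
    moreover have "exp (- s2) / (A * (\<alpha> + A)) \<le> exp (- s1) / (A * (\<alpha> + A))"
      using s AA by (intro divide_right_mono) auto
    ultimately have "b2 \<le> b1"
      unfolding b1_def b2_def using A u \<alpha>0 AA by (intro mult_mono) auto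
    moreover have "0 \<le> b2" unfolding b2_def using A u \<alpha>0 AA by simp
    ultimately have b: "0 \<le> b2" "b2 \<le> b1" by simp_all
    have "\<bar>sin \<theta>1\<bar> \<le> \<alpha> + u1" "\<bar>sin \<theta>2\<bar> \<le> \<alpha> + u2"
      using u \<alpha> abs_sin_le_one[of \<theta>1] abs_sin_le_one[of \<theta>2] by linarith+
    then have k_le: "k1 \<le> 1" "k2 \<le> 1"
      unfolding k1_def k2_def using u \<alpha> by (auto simp: divide_le_eq)
    have "b1 \<le> exp (- s1) / 1 * 1"
      unfolding b1_def using A u \<alpha>0 AA
      by (intro mult_mono divide_left_mono) (auto simp: divide_le_eq)
    also have "\<dots> \<le> a1" using exp_minus_cosh_le_1[OF s(1)] by (simp add: a1_def field_simps)
    finally have "b1 \<le> a1" .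
    moreover have "k1 * k2 \<le> 1" using k k_le by (intro mult_le_one) auto
    then have "b1 * (k1 * k2) \<le> b1" using b k by (intro mult_left_le) auto
    ultimately have bk: "b1 * (k1 * k2) \<le> a1" by simp
    have f: "a2 / k2 + b2 * k2 < a1 / k1 + b1 * k1"
      by (rule recip_plus_linear_strict_decreasing) (use a b k bk in auto)
    have f0: "0 < a2 / k2 + b2 * k2" using a b k by (intro add_pos_nonneg) auto
    have "A * \<bar>x\<bar> = exp (eps_of_alpha \<alpha> * s1) / (a1 / k1 + b1 * k1)"
      using abs_x_eq[OF \<alpha>0 p1 False] by (simp add: A_def a1_def k1_def b1_def u1_def)
    also have "\<dots> < exp (eps_of_alpha \<alpha> * s2) / (a2 / k2 + b2 * k2)"
      using f f0 s eps_pos[OF \<alpha>0] by (intro frac_less) auto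
    also have "\<dots> = A * \<bar>x\<bar>"
      using abs_x_eq[OF \<alpha>0 p2 s2] by (simp add: A_def a2_def k2_def b2_def u2_def)
    finally show False by simp
  qed
qed

lemma height_determined:
  assumes \<alpha>: "1 \<le> \<alpha>" and s: "0 \<le> s1" "0 \<le> s2"
    and p1: "catenoid_param \<alpha> (s1, \<theta>1) = (x, y1, z)"
    and p2: "catenoid_param \<alpha> (s2, \<theta>2) = (x, y2, z)"
  shows "y1 = y2"
proof -
  have \<alpha>0: "0 < \<alpha>" using \<alpha> by simp
  have eq: "s1 = s2"
    using no_two_sheets[OF \<alpha> s(1) _ p1 p2] no_two_sheets[OF \<alpha> s(2) _ p2 p1] by force
  have "\<bar>cos \<theta>1\<bar> / (\<alpha> + speed \<alpha> \<bar>cos \<theta>1\<bar>) * cosh s1 = \<bar>cos \<theta>2\<bar> / (\<alpha> + speed \<alpha> \<bar>cos \<theta>2\<bar>) * cosh s1"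
    using abs_z_eq[OF \<alpha>0 p1] abs_z_eq[OF \<alpha>0 p2] eq by simp
  then have "\<bar>cos \<theta>1\<bar> / (\<alpha> + speed \<alpha> \<bar>cos \<theta>1\<bar>) = \<bar>cos \<theta>2\<bar> / (\<alpha> + speed \<alpha> \<bar>cos \<theta>2\<bar>)"
    by (metis cosh_real_nonzero mult_right_cancel)
  then have "\<bar>cos \<theta>1\<bar> = \<bar>cos \<theta>2\<bar>"
    using divide_speed_strict_mono[OF \<alpha>0, of "\<bar>cos \<theta>1\<bar>" "\<bar>cos \<theta>2\<bar>"]
      divide_speed_strict_mono[OF \<alpha>0, of "\<bar>cos \<theta>2\<bar>" "\<bar>cos \<theta>1\<bar>"] by linarith
  then have "(cos \<theta>1)\<^sup>2 = (cos \<theta>2)\<^sup>2" by (simp add: abs_eq_iff power2_eq_iff)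
  then have "omega_excess \<alpha> s1 \<theta>1 = omega_excess \<alpha> s1 \<theta>2"
    by (simp add: omega_excess_def sin_squared_eq)
  then show ?thesis using p1 p2 eq by (simp add: catenoid_param_iff)
qed

section \<open>At least one point over each \<open>(x, z)\<close>\<close>

lemma catenoid_param_reflect:
  "catenoid_param \<alpha> (s, \<theta>) = (x, y, z) \<Longrightarrow> catenoid_param \<alpha> (s, - \<theta>) = (- x, y, z)"
  by (simp add: catenoid_param_iff omega_excess_def)

text \<open>The equation for \<open>z\<close> reads \<open>c / (\<alpha> + u(c)) = t\<close> with \<open>t = \<alpha> z / cosh s\<close>. Together with
  \<open>(u - \<alpha>) / (u + \<alpha>) = t\<^sup>2\<close> it has the solution \<open>c = 2\<alpha>t / (1 - t\<^sup>2)\<close>, which is a cosine exactly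
  when \<open>\<bar>t\<bar> \<le> q = \<alpha>\<^sub>* - \<alpha> = 1 / (\<alpha> + \<alpha>\<^sub>*)\<close>, that is, when \<open>cosh s \<ge> \<bar>z\<bar> \<alpha> (\<alpha> + \<alpha>\<^sub>*)\<close>. Along
  this curve of constant \<open>z\<close> the intermediate value theorem applies to the first coordinate
  \<open>X\<close>. At the left end, either \<open>\<bar>c\<bar> = 1\<close>, so \<open>X = 0\<close>, or \<open>s = 0\<close>, where \<open>X\<close> is at most
  \<open>1 / (\<alpha>\<^sub>* \<alpha>)\<close>; the disjunction in the hypothesis guarantees \<open>X \<le> x\<close> there in both cases.\<close>
lemma exists_param_nonneg:
  assumes \<alpha>: "1 \<le> \<alpha>" and x0: "0 \<le> x"
    and big: "1 \<le> \<bar>z\<bar> * (\<alpha> * (\<alpha> + alpha_star \<alpha>)) \<or> 1 \<le> x * (alpha_star \<alpha> * \<alpha>)"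
  shows "\<exists>s \<theta> y. 0 \<le> s \<and> catenoid_param \<alpha> (s, \<theta>) = (x, y, z)"
proof -
  define A where "A = alpha_star \<alpha>"
  define \<epsilon> where "\<epsilon> = eps_of_alpha \<alpha>"
  define N where "N = \<alpha> * (\<alpha> + A)"
  define q where "q = A - \<alpha>"
  have \<alpha>0: "0 < \<alpha>" using \<alpha> by simp
  have \<epsilon>: "0 < \<epsilon>" using eps_pos[OF \<alpha>0] by (simp add: \<epsilon>_def)
  have A: "\<alpha> < A" using alpha_less_alpha_star[OF \<alpha>0] by (simp add: A_def)
  have A2: "A\<^sup>2 = \<alpha>\<^sup>2 + 1" by (simp add: A_def alpha_star_sq)
  have q: "q * (\<alpha> + A) = 1" "0 < q" using A A2
    by (simp_all add: q_def algebra_simps power2_eq_square)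
  have q1: "q < 1"
  proof -
    have "q * 1 < q * (\<alpha> + A)" using q A \<alpha> by (intro mult_strict_left_mono) auto
    then show ?thesis using q by simp
  qed
  have q2: "1 - q\<^sup>2 = 2 * \<alpha> * q"
    using A2 by (simp add: q_def power2_eq_square algebra_simps)
  have A2\<alpha>: "A \<le> 2 * \<alpha>"
  proof (rule power2_le_imp_le)
    have "1 \<le> \<alpha>\<^sup>2" using \<alpha> by simp
    then show "A\<^sup>2 \<le> (2 * \<alpha>)\<^sup>2" using A2 by (simp add: power_mult_distrib)
  qed (use \<alpha>0 in simp)
  have N: "1 \<le> N" using mult_mono[of 1 \<alpha> 1 "\<alpha> + A"] \<alpha> A by (simp add: N_def)
  define M where "M = x + \<bar>z\<bar> + 1"
  have M: "1 \<le> M" "x \<le> M" "\<bar>z\<bar> \<le> M" using x0 by (auto simp: M_def)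
  \<comment> \<open>The right end is far enough out that \<open>\<bar>cos \<theta>\<bar> \<le> 1/8\<close> and hence \<open>X \<ge> M\<close> there.\<close>
  define s0 where "s0 = arcosh (max 1 (\<bar>z\<bar> * N))"
  define s1 where "s1 = arcosh (8 * M * N)"
  have MN: "1 \<le> M * N" using mult_mono[of 1 M 1 N] M N by simp
  have zN: "\<bar>z\<bar> * N \<le> M * N" using M N by (intro mult_right_mono) auto
  have cosh0: "cosh s0 = max 1 (\<bar>z\<bar> * N)" by (simp add: s0_def cosh_arcosh_real)
  have cosh1: "cosh s1 = 8 * M * N" using MN by (simp add: s1_def cosh_arcosh_real)
  have s0: "0 \<le> s0" unfolding s0_def by (rule arcosh_nonneg_real) simp
  have s1: "0 \<le> s1" unfolding s1_def by (rule arcosh_nonneg_real) (use MN in simp)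
  have s01: "s0 \<le> s1"
    using s0 s1 cosh_real_nonneg_le_iff[of s0 s1] cosh0 cosh1 MN zN by auto
  define t where "t s = \<alpha> * z / cosh s" for s
  define c where "c s = 2 * \<alpha> * t s / (1 - (t s)\<^sup>2)" for s
  have t_le: "\<bar>t s\<bar> \<le> q" if "s0 \<le> s" for s
  proof -
    have "cosh s0 \<le> cosh s" using s0 that by (simp add: cosh_real_nonneg_le_iff)
    then have "\<bar>z\<bar> * N \<le> cosh s" using cosh0 by simp
    then have "q * (\<bar>z\<bar> * N) \<le> q * cosh s" using q by (intro mult_left_mono) auto
    moreover have "q * (\<bar>z\<bar> * N) = \<alpha> * \<bar>z\<bar> * (q * (\<alpha> + A))" by (simp add: N_def)
    ultimately have "\<alpha> * \<bar>z\<bar> \<le> q * cosh s" using q by simp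
    then show ?thesis using \<alpha>0 by (simp add: t_def abs_mult divide_le_eq)
  qed
  have t2: "(t s)\<^sup>2 \<le> q\<^sup>2" "(t s)\<^sup>2 < 1" if "s0 \<le> s" for s
  proof -
    show *: "(t s)\<^sup>2 \<le> q\<^sup>2" using t_le[OF that] q by (simp add: abs_le_square_iff[symmetric])
    have "q\<^sup>2 < 1" using q q1 by (simp add: abs_square_less_1)
    then show "(t s)\<^sup>2 < 1" using * by simp
  qed
  have c_abs: "\<bar>c s\<bar> = 2 * \<alpha> * \<bar>t s\<bar> / (1 - (t s)\<^sup>2)" if "s0 \<le> s" for s
    using t2(2)[OF that] \<alpha>0 by (simp add: c_def abs_mult)
  have c_le: "\<bar>c s\<bar> \<le> 1" if "s0 \<le> s" for s
  proof -
    have "\<bar>c s\<bar> \<le> 2 * \<alpha> * q / (1 - q\<^sup>2)"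
      unfolding c_abs[OF that] using t_le[OF that] t2[OF that] \<alpha>0 q q2
      by (intro frac_le) auto
    then show ?thesis using q2 q \<alpha>0 by simp
  qed
  have speed_c: "\<alpha> + speed \<alpha> (c s) = 2 * \<alpha> / (1 - (t s)\<^sup>2)" if "s0 \<le> s" for s
  proof -
    define w where "w = 1 - (t s)\<^sup>2"
    have w: "0 < w" "w \<le> 1" "(t s)\<^sup>2 = 1 - w" using t2(2)[OF that] by (auto simp: w_def)
    have "(c s)\<^sup>2 = 4 * \<alpha>\<^sup>2 * (1 - w) / w\<^sup>2"
      unfolding c_def w_def[symmetric] by (simp add: power_divide power_mult_distrib w(3))
    then have "\<alpha>\<^sup>2 + (c s)\<^sup>2 = (\<alpha> * (2 - w) / w)\<^sup>2"
      using w(1) by (simp add: field_simps power2_eq_square)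
    then have "speed \<alpha> (c s) = \<alpha> * (2 - w) / w"
      using w \<alpha>0 by (simp add: real_sqrt_unique)
    then show ?thesis using w by (simp add: w_def[symmetric] field_simps)
  qed
  have cos_c: "cos (arccos (c s)) = c s" if "s0 \<le> s" for s
    using c_le[OF that] by (simp add: abs_le_iff)
  have z: "c s / (\<alpha> * (\<alpha> + speed \<alpha> (c s))) * cosh s = z" if "s0 \<le> s" for s
  proof -
    have "c s / (\<alpha> * (\<alpha> + speed \<alpha> (c s))) = t s / \<alpha>"
      unfolding speed_c[OF that] using t2(2)[OF that] \<alpha>0 by (simp add: c_def field_simps)
    then show ?thesis using \<alpha>0 by (simp add: t_def)
  qed
  define Y where "Y s = exp (\<epsilon> * s) / (1 + omega_excess \<alpha> s (arccos (c s)))" for s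
  define X where "X s = sin (arccos (c s)) / (A * (\<alpha> + speed \<alpha> (cos (arccos (c s))))) * cosh s * Y s" for s
  have param: "catenoid_param \<alpha> (s, arccos (c s)) = (X s, Y s, z)" if "s0 \<le> s" for s
    unfolding catenoid_param_iff using z[OF that] cos_c[OF that]
    by (simp add: X_def Y_def A_def \<epsilon>_def)
  have u_pos: "0 < speed \<alpha> v" for v using speed_ge[OF \<alpha>0, of v] \<alpha>0 by linarith
  have nz: "A \<noteq> 0" "\<alpha> + A \<noteq> 0" "\<alpha> + speed \<alpha> v \<noteq> 0" "A + speed \<alpha> v \<noteq> 0"
      "1 + omega_excess \<alpha> s v \<noteq> 0" for s v
    using A \<alpha>0 u_pos[of v] omega_excess_nonneg[OF \<alpha>0, of s v] by linarith+
  have cont_c: "continuous_on {s0..s1} c"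
    unfolding c_def t_def    by (intro continuous_intros) (use t2(2) in \<open>force simp: t_def\<close>)+
  have cont_acos: "continuous_on {s0..s1} (\<lambda>s. arccos (c s))"
    using c_le by (intro continuous_on_arccos cont_c) (auto simp: abs_le_iff)
  have cont_om: "continuous_on {s0..s1} (\<lambda>s. omega_excess \<alpha> s (arccos (c s)))"
    unfolding omega_excess_def A_def[symmetric]
    by (intro continuous_intros cont_acos) (simp add: nz)
  have cont: "continuous_on {s0..s1} X"
    unfolding X_def Y_def
    by (intro continuous_intros cont_acos cont_om) (simp_all add: nz)
  have lo: "X s0 \<le> x"
  proof (cases "1 \<le> \<bar>z\<bar> * N")
    case True
    then have "\<bar>t s0\<bar> = \<alpha> * \<bar>z\<bar> / (\<bar>z\<bar> * N)" using cosh0 \<alpha>0 N by (simp add: t_def abs_mult)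
    also have "\<dots> = 1 / (\<alpha> + A)" using True \<alpha>0 A by (auto simp: N_def)
    also have "\<dots> = q" using q A \<alpha>0 by (simp add: field_simps)
    finally have tq: "\<bar>t s0\<bar> = q" .
    then have "(t s0)\<^sup>2 = q\<^sup>2" using power2_abs[of "t s0"] by simp
    then have "\<bar>c s0\<bar> = 1" using c_abs[of s0] tq q2 q \<alpha>0 by simp
    then have "(c s0)\<^sup>2 = 1" by (simp add: abs_square_eq_1)
    then have "sin (arccos (c s0)) = 0"
      using c_le[of s0] by (simp add: sin_arccos_abs)
    then show ?thesis using x0 by (simp add: X_def)
  next
    case False
    then have x1: "1 \<le> x * (A * \<alpha>)" using big by (simp add: N_def A_def)
    have cs: "cosh s0 = 1" using cosh0 False by simp
    then have s00: "s0 = 0" by (simp add: cosh_real_one_iff)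
    have Y: "Y s0 \<le> 1" "0 \<le> Y s0"
      using omega_excess_nonneg[OF \<alpha>0, of s0 "arccos (c s0)"]
      by (simp_all add: Y_def s00 divide_le_eq)
    have "sin (arccos (c s0)) / (A * (\<alpha> + speed \<alpha> (cos (arccos (c s0))))) \<le> 1 / (A * \<alpha>)"
      using A \<alpha>0 u_pos by (intro frac_le mult_left_mono) (auto simp: less_imp_le)
    then have "X s0 \<le> 1 / (A * \<alpha>) * 1"
      unfolding X_def cs using Y A \<alpha>0 by (intro mult_mono) auto
    also have "\<dots> \<le> x" using x1 A \<alpha>0 by (simp add: divide_le_eq)
    finally show ?thesis .
  qed
  have hi: "x \<le> X s1"
  proof -
    define \<theta> where "\<theta> = arccos (c s1)"
    define u where "u = speed \<alpha> (cos \<theta>)"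
    have u: "\<alpha> \<le> u" "u \<le> A"
      using speed_ge[OF \<alpha>0] speed_cos_le_alpha_star by (auto simp: u_def A_def)
    have zc: "\<bar>z\<bar> * \<alpha> = \<bar>cos \<theta>\<bar> / (\<alpha> + u) * (8 * M * N)"
      using abs_z_eq[OF \<alpha>0 param[OF s01]] unfolding \<theta>_def[symmetric] cosh1 by (simp add: u_def)
    have "\<bar>cos \<theta>\<bar> * (8 * M * N) = \<bar>z\<bar> * (\<alpha> * (\<alpha> + u))" using zc u \<alpha>0 by (simp add: field_simps)
    also have "\<dots> \<le> M * N"
      unfolding N_def using M u \<alpha>0 by (intro mult_mono) auto
    finally have "(8 * \<bar>cos \<theta>\<bar>) * (M * N) \<le> 1 * (M * N)" by simp
    then have "8 * \<bar>cos \<theta>\<bar> \<le> 1" by (rule mult_right_le_imp_le) (use MN in simp)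
    then have "\<bar>cos \<theta>\<bar>\<^sup>2 \<le> (1/8)\<^sup>2" by (intro power_mono) auto
    then have "(1/2)\<^sup>2 \<le> (sin \<theta>)\<^sup>2"
      unfolding power2_abs sin_squared_eq by (simp add: power_divide)
    moreover have sin0: "0 \<le> sin \<theta>"
      using c_le[OF s01] unfolding \<theta>_def
      by (intro sin_ge_zero arccos_lbound arccos_ubound) (auto simp: abs_le_iff)
    ultimately have sin: "1/2 \<le> sin \<theta>" by (rule power2_le_imp_le)
    have "omega_excess \<alpha> s1 \<theta> \<le> 1 / (8 * \<alpha> ^ 4)" by (rule omega_excess_le[OF \<alpha>0 s1])
    also have "\<dots> \<le> 1" using one_le_power[OF \<alpha>, of 4] by (simp add: divide_le_eq)
    finally have om: "omega_excess \<alpha> s1 \<theta> \<le> 1" .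
    have "1 \<le> exp (\<epsilon> * s1)" using \<epsilon> s1 by simp
    then have Y: "1/2 \<le> Y s1" unfolding Y_def \<theta>_def[symmetric]
      using om omega_excess_nonneg[OF \<alpha>0, of s1 \<theta>] by (intro frac_le) auto
    have "M * A \<le> M * (2 * \<alpha>)" using A2\<alpha> M by (intro mult_left_mono) auto
    then have "M \<le> 2 * M * \<alpha> / A" using A \<alpha>0 by (simp add: le_divide_eq mult_ac)
    also have "\<dots> = (1/2) / (A * (\<alpha> + A)) * (8 * M * N) * (1/2)"
      using nz(2) by (simp add: N_def)
    also have "\<dots> \<le> sin \<theta> / (A * (\<alpha> + u)) * (8 * M * N) * Y s1"
      using sin Y u A \<alpha>0 M N by (intro mult_mono frac_le) auto
    also have "\<dots> = X s1" by (simp add: X_def cosh1 u_def \<theta>_def)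
    finally show ?thesis using M by simp
  qed
  obtain s where "s0 \<le> s" "X s = x" using IVT'[OF lo hi s01 cont] by blast
  then have "0 \<le> s" "catenoid_param \<alpha> (s, arccos (c s)) = (x, Y s, z)"
    using param[of s] s0 by simp_all
  then show ?thesis by blast
qed

lemma exists_param:
  assumes \<alpha>: "1 \<le> \<alpha>"
    and big: "1 \<le> \<bar>z\<bar> * (\<alpha> * (\<alpha> + alpha_star \<alpha>)) \<or> 1 \<le> \<bar>x\<bar> * (alpha_star \<alpha> * \<alpha>)"
  shows "\<exists>s \<theta> y. 0 \<le> s \<and> catenoid_param \<alpha> (s, \<theta>) = (x, y, z)"
proof -
  obtain s \<theta> y where *: "0 \<le> s" "catenoid_param \<alpha> (s, \<theta>) = (\<bar>x\<bar>, y, z)"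
    using exists_param_nonneg[OF \<alpha> abs_ge_zero big] by blast
  show ?thesis
  proof (cases "0 \<le> x")
    case True
    then show ?thesis using * by auto
  next
    case False
    then show ?thesis using catenoid_param_reflect[OF *(2)] *(1) by auto
  qed
qed

section \<open>The expansion of the height\<close>

lemma sqrt_sin_cos_bounds:
  assumes "0 \<le> l" "l \<le> a" "l \<le> b" "a \<le> h" "b \<le> h"
  shows "l \<le> sqrt ((sin \<theta> * a)\<^sup>2 + (cos \<theta> * b)\<^sup>2)" "sqrt ((sin \<theta> * a)\<^sup>2 + (cos \<theta> * b)\<^sup>2) \<le> h"
proof -
  have unit: "(sin \<theta>)\<^sup>2 * v + (cos \<theta>)\<^sup>2 * v = v" for v
    by (simp flip: distrib_right)
  have "l\<^sup>2 \<le> a\<^sup>2" "l\<^sup>2 \<le> b\<^sup>2" "a\<^sup>2 \<le> h\<^sup>2" "b\<^sup>2 \<le> h\<^sup>2" using assms by (auto intro: power_mono)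
  then have "(sin \<theta>)\<^sup>2 * l\<^sup>2 + (cos \<theta>)\<^sup>2 * l\<^sup>2 \<le> (sin \<theta>)\<^sup>2 * a\<^sup>2 + (cos \<theta>)\<^sup>2 * b\<^sup>2"
     "(sin \<theta>)\<^sup>2 * a\<^sup>2 + (cos \<theta>)\<^sup>2 * b\<^sup>2 \<le> (sin \<theta>)\<^sup>2 * h\<^sup>2 + (cos \<theta>)\<^sup>2 * h\<^sup>2"
    by (auto intro!: add_mono mult_left_mono)
  then have "l\<^sup>2 \<le> (sin \<theta> * a)\<^sup>2 + (cos \<theta> * b)\<^sup>2" "(sin \<theta> * a)\<^sup>2 + (cos \<theta> * b)\<^sup>2 \<le> h\<^sup>2"
    by (simp_all add: unit power_mult_distrib)
  then show "l \<le> sqrt ((sin \<theta> * a)\<^sup>2 + (cos \<theta> * b)\<^sup>2)" "sqrt ((sin \<theta> * a)\<^sup>2 + (cos \<theta> * b)\<^sup>2) \<le> h"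
    using assms by (auto intro: real_le_rsqrt real_le_lsqrt)
qed

lemma eps_alpha_relation:
  assumes "\<alpha> > 0"
  shows "\<alpha>\<^sup>2 * (eps_of_alpha \<alpha> * (eps_of_alpha \<alpha> + 2)) = 1"
proof -
  have "((1 + eps_of_alpha \<alpha>) * \<alpha>)\<^sup>2 = \<alpha>\<^sup>2 + 1"
    using alpha_star_sq[of \<alpha>] alpha_star_eq[OF assms] by simp
  then show ?thesis by (simp add: power2_eq_square algebra_simps)
qed

text \<open>The vector \<open>(x, z) / cosh s\<close> is \<open>(a sin \<theta>, b cos \<theta>)\<close> with \<open>a = y / (\<alpha>\<^sub>* (\<alpha> + u))\<close> and
  \<open>b = 1 / (\<alpha> (\<alpha> + u))\<close>, so its length lies between common bounds of \<open>a\<close> and \<open>b\<close>. These come from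
  the extreme cases \<open>u = \<alpha>\<close>, where \<open>1 / (2\<alpha>\<^sup>2) = \<epsilon> (1 + \<epsilon>/2)\<close>, and \<open>u = \<alpha>\<^sub>*\<close>, where
  \<open>1 / (\<alpha>\<^sub>* (\<alpha> + \<alpha>\<^sub>*)) = \<epsilon> / (1 + \<epsilon>)\<close>.\<close>
lemma radius_bounds:
  assumes \<alpha>: "\<alpha> > 0" and s: "0 \<le> s" and p: "catenoid_param \<alpha> (s, \<theta>) = (x, y, z)"
  defines "\<epsilon> \<equiv> eps_of_alpha \<alpha>"
  shows "sqrt (x\<^sup>2 + z\<^sup>2) \<le> \<epsilon> * (1 + \<epsilon> / 2) * exp (\<epsilon> * s) * cosh s"
    and "1 \<le> y \<Longrightarrow> \<epsilon> / (1 + \<epsilon>) * cosh s \<le> sqrt (x\<^sup>2 + z\<^sup>2)"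
proof -
  define A where "A = alpha_star \<alpha>"
  define u where "u = speed \<alpha> (cos \<theta>)"
  define E where "E = exp (\<epsilon> * s)"
  have \<epsilon>: "0 < \<epsilon>" using eps_pos[OF \<alpha>] by (simp add: \<epsilon>_def)
  have u: "\<alpha> \<le> u" "u \<le> A"
    using speed_ge[OF \<alpha>] speed_cos_le_alpha_star by (auto simp: u_def A_def)
  have A: "\<alpha> < A" "A = (1 + \<epsilon>) * \<alpha>"
    using alpha_less_alpha_star[OF \<alpha>] alpha_star_eq[OF \<alpha>] by (simp_all add: A_def \<epsilon>_def)
  have rel: "\<alpha>\<^sup>2 * (\<epsilon> * (\<epsilon> + 2)) = 1" using eps_alpha_relation[OF \<alpha>] by (simp add: \<epsilon>_def)
  define a where "a = y / (A * (\<alpha> + u))"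
  define b where "b = 1 / (\<alpha> * (\<alpha> + u))"
  have om: "0 \<le> omega_excess \<alpha> s \<theta>" by (rule omega_excess_nonneg[OF \<alpha>])
  have y: "y = E / (1 + omega_excess \<alpha> s \<theta>)"
    using p by (simp add: catenoid_param_iff E_def \<epsilon>_def)
  have E: "1 \<le> E" using \<epsilon> s by (simp add: E_def)
  have yE: "0 < y" "y \<le> E"
    using y om E mult_left_mono[of 1 "1 + omega_excess \<alpha> s \<theta>" E] by (auto simp: divide_le_eq)
  have "x = sin \<theta> * a * cosh s" "z = cos \<theta> * b * cosh s"
    using p by (simp_all add: catenoid_param_iff a_def b_def A_def u_def)
  then have "x\<^sup>2 + z\<^sup>2 = ((sin \<theta> * a)\<^sup>2 + (cos \<theta> * b)\<^sup>2) * (cosh s)\<^sup>2"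
    by (simp add: power_mult_distrib distrib_right)
  then have r: "sqrt (x\<^sup>2 + z\<^sup>2) = sqrt ((sin \<theta> * a)\<^sup>2 + (cos \<theta> * b)\<^sup>2) * cosh s"
    by (simp add: real_sqrt_mult)
  have "1 / (\<alpha> * (\<alpha> + u)) \<le> 1 / (2 * \<alpha>\<^sup>2)"
    using u \<alpha> by (intro frac_le) (auto simp: power2_eq_square)
  also have "\<dots> = \<epsilon> * (1 + \<epsilon> / 2)" using rel \<alpha> by (simp add: field_simps)
  finally have b_up: "b \<le> \<epsilon> * (1 + \<epsilon> / 2)" by (simp add: b_def)
  have b0: "0 < b" using u \<alpha> by (simp add: b_def)
  have "b \<le> b * E" using b0 E by simp
  also have "\<dots> \<le> \<epsilon> * (1 + \<epsilon> / 2) * E" using b_up E by (intro mult_right_mono) auto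
  finally have b_up': "b \<le> \<epsilon> * (1 + \<epsilon> / 2) * E" .
  have "a \<le> E / (\<alpha> * (\<alpha> + u))"
    unfolding a_def using yE E A u \<alpha> by (intro frac_le mult_right_mono) auto
  also have "\<dots> = b * E" by (simp add: b_def)
  also have "\<dots> \<le> \<epsilon> * (1 + \<epsilon> / 2) * E" using b_up E by (intro mult_right_mono) auto
  finally have a_up: "a \<le> \<epsilon> * (1 + \<epsilon> / 2) * E" .
  have a0: "0 < a" using yE A u \<alpha> by (simp add: a_def)
  show "sqrt (x\<^sup>2 + z\<^sup>2) \<le> \<epsilon> * (1 + \<epsilon> / 2) * exp (\<epsilon> * s) * cosh s"
    unfolding r E_def[symmetric]
    by (intro mult_right_mono sqrt_sin_cos_bounds(2)[of 0] a_up b_up') (use a0 b0 in auto)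
  assume y1: "1 \<le> y"
  have l: "\<epsilon> / (1 + \<epsilon>) = 1 / (A * (\<alpha> + A))"
  proof -
    have "A * (\<alpha> + A) * \<epsilon> = (1 + \<epsilon>) * (\<alpha>\<^sup>2 * (\<epsilon> * (\<epsilon> + 2)))"
      unfolding A(2) by (simp add: power2_eq_square algebra_simps)
    then have "A * (\<alpha> + A) * \<epsilon> = 1 + \<epsilon>" using rel by simp
    then have "\<epsilon> / (1 + \<epsilon>) = \<epsilon> / (A * (\<alpha> + A) * \<epsilon>)" by (simp only:)
    then show ?thesis using \<epsilon> by simp
  qed
  have "\<epsilon> / (1 + \<epsilon>) \<le> b" unfolding l b_def using u A \<alpha> by (intro frac_le mult_mono) auto
  moreover have "\<epsilon> / (1 + \<epsilon>) \<le> a" unfolding l a_def using u A \<alpha> y1 by (intro frac_le mult_mono) auto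
  ultimately show "\<epsilon> / (1 + \<epsilon>) * cosh s \<le> sqrt (x\<^sup>2 + z\<^sup>2)"
    unfolding r using \<epsilon> by (intro mult_right_mono sqrt_sin_cos_bounds(1)[where h = "max a b"]) auto
qed

lemma omega_excess_le_eps:
  assumes \<alpha>: "\<alpha> > 0" and s: "0 \<le> s" and "eps_of_alpha \<alpha> \<le> 1"
  shows "omega_excess \<alpha> s \<theta> \<le> 2 * (eps_of_alpha \<alpha>)\<^sup>2"
proof -
  define \<epsilon> where "\<epsilon> = eps_of_alpha \<alpha>"
  have \<epsilon>: "0 < \<epsilon>" "\<epsilon> \<le> 1" using eps_pos[OF \<alpha>] assms(3) by (simp_all add: \<epsilon>_def)
  have inv: "1 / \<alpha>\<^sup>2 = \<epsilon> * (\<epsilon> + 2)"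
    using eps_alpha_relation[OF \<alpha>] \<alpha> by (simp add: \<epsilon>_def field_simps)
  have "omega_excess \<alpha> s \<theta> \<le> 1 / (8 * \<alpha> ^ 4)" by (rule omega_excess_le[OF \<alpha> s])
  also have "\<dots> = (1 / \<alpha>\<^sup>2)\<^sup>2 / 8" by (simp add: power_divide flip: power_mult)
  also have "\<dots> = (\<epsilon> * (\<epsilon> + 2))\<^sup>2 / 8" by (simp only: inv)
  also have "\<dots> \<le> (\<epsilon> * 4)\<^sup>2 / 8" using \<epsilon> by (intro divide_right_mono power_mono mult_left_mono) auto
  also have "\<dots> = 2 * \<epsilon>\<^sup>2" by (simp add: power_mult_distrib)
  finally show ?thesis by (simp add: \<epsilon>_def)
qed

text \<open>The upper bound for \<open>r\<close> turns the assumed lower bound into \<open>s \<ge> 1/2\<close>, after which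
  \<open>\<delta> \<le> 2\<epsilon>\<^sup>2 \<le> \<epsilon>s\<close>.\<close>
lemma height_ge_1:
  assumes \<alpha>: "\<alpha> > 0" and s: "0 \<le> s" and p: "catenoid_param \<alpha> (s, \<theta>) = (x, y, z)"
  defines "\<epsilon> \<equiv> eps_of_alpha \<alpha>"
  assumes \<epsilon>: "\<epsilon> \<le> 1/4" and r: "2 * exp 1 * \<epsilon> \<le> sqrt (x\<^sup>2 + z\<^sup>2)"
  shows "1 \<le> y"
proof -
  have \<epsilon>0: "0 < \<epsilon>" using eps_pos[OF \<alpha>] by (simp add: \<epsilon>_def)
  have "cosh s \<le> exp s" using s by (simp add: cosh_def)
  have "\<epsilon> * s \<le> 1 * s" using \<epsilon> s by (intro mult_right_mono) auto
  have "2 * exp 1 * \<epsilon> \<le> \<epsilon> * (1 + \<epsilon> / 2) * exp (\<epsilon> * s) * cosh s"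
    using r radius_bounds(1)[OF \<alpha> s p] by (simp add: \<epsilon>_def)
  also have "\<dots> \<le> \<epsilon> * 2 * exp (1 * s) * exp s"
    using \<epsilon> \<epsilon>0 s \<open>cosh s \<le> exp s\<close> \<open>\<epsilon> * s \<le> 1 * s\<close> by (intro mult_mono) auto
  also have "\<dots> = (2 * \<epsilon>) * exp (2 * s)" by (simp flip: exp_add)
  finally have "(2 * \<epsilon>) * exp 1 \<le> (2 * \<epsilon>) * exp (2 * s)" by (simp add: mult_ac)
  then have s2: "1/2 \<le> s" using \<epsilon>0 by simp
  have "omega_excess \<alpha> s \<theta> \<le> 2 * \<epsilon>\<^sup>2"
    using \<epsilon> omega_excess_le_eps[OF \<alpha> s, of \<theta>] by (simp add: \<epsilon>_def)
  also have "\<dots> \<le> \<epsilon> * s"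
    using \<epsilon> \<epsilon>0 s2 mult_mono[of \<epsilon> "1/4" \<epsilon> \<epsilon>] mult_mono[of \<epsilon> \<epsilon> "1/2" s] by (simp add: power2_eq_square)
  finally have "1 + omega_excess \<alpha> s \<theta> \<le> exp (\<epsilon> * s)"
    using exp_ge_add_one_self[of "\<epsilon> * s"] by linarith
  then show ?thesis
    using p omega_excess_nonneg[OF \<alpha>, of s \<theta>] by (simp add: catenoid_param_iff \<epsilon>_def le_divide_eq)
qed

text \<open>This keeps the exponent \<open>\<epsilon>s\<close>, with \<open>s \<le> 2 log (1/\<epsilon>)\<close>, in \<open>[0, 1]\<close>, where \<open>e\<^bsup>\<epsilon>s\<^esup>\<close> differs from
  \<open>1 + \<epsilon>s\<close> by at most \<open>(\<epsilon>s)\<^sup>2\<close>.\<close>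
lemma ln_inverse_mult_le:
  assumes "0 < (\<epsilon>::real)"
  shows "- (2 * \<epsilon> * ln \<epsilon>) \<le> 1"
proof -
  have "ln (1 / (2 * \<epsilon>)) \<le> 1 / (2 * \<epsilon>) - 1" using assms by (intro ln_le_minus_one) simp
  then have "- ln \<epsilon> \<le> 1 / (2 * \<epsilon>) + ln 2 - 1" using assms by (simp add: ln_div ln_mult)
  also have "\<dots> \<le> 1 / (2 * \<epsilon>)" using ln_2_less_1 by simp
  finally show ?thesis using assms by (simp add: field_simps)
qed

text \<open>With \<open>L = log (2r/\<epsilon>)\<close> and \<open>l = log (1/\<epsilon>)\<close>, the error splits into \<open>y - e\<^bsup>\<epsilon>s\<^esup>\<close>, which is
  \<open>O(\<epsilon>\<^sup>2)\<close> through \<open>\<omega>\<close>; the Taylor remainder, at most \<open>(\<epsilon>s)\<^sup>2 \<le> 4\<epsilon>\<^sup>2l\<^sup>2\<close>; and \<open>\<epsilon> (s - L)\<close>. For the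
  last one, \<open>\<bar>s - L\<bar> \<le> \<epsilon> (2l + 1 + 6\<rho>)\<close> by the two bounds on \<open>r\<close>. The assumption on \<open>\<epsilon>\<close> ensures
  \<open>l \<ge> 1 + log (2\<rho>)\<close>, so that \<open>L < 2l\<close> and lower powers of \<open>l\<close> are absorbed in \<open>l\<^sup>2\<close>.\<close>
lemma height_expansion:
  assumes \<rho>: "1 < \<rho>" and \<alpha>: "\<alpha> > 0" and s: "0 \<le> s"
    and p: "catenoid_param \<alpha> (s, \<theta>) = (x, y, z)" and y: "1 \<le> y"
  defines "\<epsilon> \<equiv> eps_of_alpha \<alpha>" and "r \<equiv> sqrt (x\<^sup>2 + z\<^sup>2)"
  assumes \<epsilon>: "\<epsilon> * (2 * \<rho> * exp 1) \<le> 1" and r: "inverse \<rho> \<le> r" "r \<le> \<rho>"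
  shows "\<bar>y - (1 - \<epsilon> * ln \<epsilon> + \<epsilon> * ln (2 * r))\<bar> \<le> (14 + 6 * \<rho>) * (\<epsilon>\<^sup>2 * (ln \<epsilon>)\<^sup>2)"
proof -
  define l where "l = - ln \<epsilon>"
  define L where "L = l + ln (2 * r)"
  have \<epsilon>0: "0 < \<epsilon>" using eps_pos[OF \<alpha>] by (simp add: \<epsilon>_def)
  have r0: "0 < r" using r \<rho> by (smt (verit) inverse_positive_iff_positive)
  have e2: "2 \<le> exp (1::real)" using exp_ge_add_one_self[of 1] by simp
  have "\<epsilon> * (2 * 1 * 2) \<le> \<epsilon> * (2 * \<rho> * exp 1)"
    using \<epsilon>0 \<rho> e2 by (intro mult_left_mono mult_mono) auto
  then have \<epsilon>4: "\<epsilon> \<le> 1/4" using \<epsilon> by simp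
  have "ln (\<epsilon> * (2 * \<rho> * exp 1)) \<le> ln 1" using \<epsilon> \<epsilon>0 \<rho> by (subst ln_le_cancel_iff) auto
  then have "ln \<epsilon> + (ln (2 * \<rho>) + 1) \<le> 0" using \<epsilon>0 \<rho> by (simp add: ln_mult)
  then have l: "1 + ln (2 * \<rho>) \<le> l" by (simp add: l_def)
  have "0 \<le> ln (2 * \<rho>)" using \<rho> by simp
  then have l1: "1 \<le> l" using l by simp
  have "ln (2 * r) \<le> ln (2 * \<rho>)" using r r0 by simp
  then have L_le: "L \<le> 2 * l - 1" using l by (simp add: L_def)
  have bounds: "r \<le> \<epsilon> * (1 + \<epsilon> / 2) * exp (\<epsilon> * s) * cosh s" "\<epsilon> / (1 + \<epsilon>) * cosh s \<le> r"
    using radius_bounds[OF \<alpha> s p] y by (simp_all add: \<epsilon>_def r_def)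
  have L_eq: "L = ln (2 * r / \<epsilon>)" using r0 \<epsilon>0 by (simp add: L_def l_def ln_div)
  have s_up: "s \<le> L + \<epsilon>"
  proof -
    have "exp s \<le> 2 * cosh s" by (simp add: cosh_def)
    also have "2 * cosh s \<le> 2 * r / \<epsilon> * (1 + \<epsilon>)" using bounds(2) \<epsilon>0 by (simp add: field_simps)
    also have "\<dots> \<le> exp L * exp \<epsilon>"
      unfolding L_eq using r0 \<epsilon>0 exp_ge_add_one_self[of \<epsilon>] by (simp add: divide_right_mono)
    finally show ?thesis by (simp flip: exp_add)
  qed
  then have s_2l: "s \<le> 2 * l" using L_le \<epsilon>4 by simp
  have "\<epsilon> * s \<le> \<epsilon> * (2 * l)" using s_2l \<epsilon>0 by (intro mult_left_mono) auto
  also have "\<dots> \<le> 1" using ln_inverse_mult_le[OF \<epsilon>0] by (simp add: l_def)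
  finally have \<epsilon>s: "\<epsilon> * s \<le> 1" .
  have \<epsilon>s0: "0 \<le> \<epsilon> * s" using \<epsilon>0 s by simp
  have e3: "exp (\<epsilon> * s) \<le> 3"
    using \<epsilon>s exp_le by (smt (verit) exp_le_cancel_iff)
  have s_lo: "L - \<epsilon> * (s + 1 + 6 * \<rho>) \<le> s"
  proof -
    have "exp L = 2 * r / \<epsilon>" unfolding L_eq using r0 \<epsilon>0 by simp
    also have "\<dots> \<le> (1 + \<epsilon> / 2) * exp (\<epsilon> * s) * (2 * cosh s)"
      using bounds(1) \<epsilon>0 by (simp add: field_simps)
    also have "\<dots> \<le> exp (\<epsilon> / 2) * exp (\<epsilon> * s) * exp (s + exp (- s))"
    proof (intro mult_mono)
      \<comment> \<open>\<open>cosh s \<le> e\<^bsup>s\<^esup>\<close> would lose \<open>log 2\<close> in \<open>s\<close>; the correction \<open>e\<^bsup>-s\<^esup>\<close> is \<open>O(\<epsilon>)\<close>\<close>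
      have "2 * cosh s = exp s * (1 + exp (- s) * exp (- s))"
        by (simp add: cosh_def algebra_simps flip: exp_add)
      also have "\<dots> \<le> exp s * (1 + exp (- s))"
        using s by (intro mult_left_mono add_mono mult_left_le) auto
      also have "\<dots> \<le> exp s * exp (exp (- s))"
        by (intro mult_left_mono exp_ge_add_one_self) auto
      finally show "2 * cosh s \<le> exp (s + exp (- s))" by (simp add: exp_add)
    qed (use \<epsilon>0 exp_ge_add_one_self in auto)
    finally have "exp L \<le> exp (\<epsilon> / 2 + \<epsilon> * s + (s + exp (- s)))" by (simp add: exp_add)
    then have *: "L \<le> \<epsilon> / 2 + \<epsilon> * s + (s + exp (- s))" by simp
    have "inverse \<rho> \<le> \<epsilon> * (1 + \<epsilon> / 2) * exp (\<epsilon> * s) * cosh s" using bounds(1) r by simp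
    also have "\<dots> \<le> \<epsilon> * 2 * 3 * exp s"
      using \<epsilon>0 \<epsilon>4 e3 s by (intro mult_mono) (auto simp: cosh_def)
    finally have "exp (- s) \<le> 6 * \<rho> * \<epsilon>" using \<rho> by (simp add: exp_minus field_simps)
    then show ?thesis using * \<epsilon>0 by (simp add: algebra_simps)
  qed
  have sL: "\<bar>s - L\<bar> \<le> \<epsilon> * (2 * l + 1 + 6 * \<rho>)"
  proof -
    have "\<epsilon> * (s + 1 + 6 * \<rho>) \<le> \<epsilon> * (2 * l + 1 + 6 * \<rho>)" using s_2l \<epsilon>0 by (intro mult_left_mono) auto
    moreover have "\<epsilon> * 1 \<le> \<epsilon> * (2 * l + 1 + 6 * \<rho>)" using l1 \<rho> \<epsilon>0 by (intro mult_left_mono) auto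
    ultimately show ?thesis using s_up s_lo by linarith
  qed
  define w where "w = omega_excess \<alpha> s \<theta>"
  have w: "0 \<le> w" "w \<le> 2 * \<epsilon>\<^sup>2"
    using omega_excess_nonneg[OF \<alpha>] omega_excess_le_eps[OF \<alpha> s] \<epsilon>4 by (simp_all add: w_def \<epsilon>_def)
  have "y = exp (\<epsilon> * s) / (1 + w)" using p by (simp add: catenoid_param_iff w_def \<epsilon>_def)
  then have "y * (1 + w) = exp (\<epsilon> * s)" using w(1) by simp
  then have yw: "exp (\<epsilon> * s) - y = y * w" unfolding distrib_left by linarith
  have yw0: "0 \<le> y * w" using y w by simp
  then have "y \<le> 3" using yw e3 by linarith
  then have "y * w \<le> 3 * (2 * \<epsilon>\<^sup>2)" using w y by (intro mult_mono) auto
  with yw yw0 have y1: "\<bar>y - exp (\<epsilon> * s)\<bar> \<le> 6 * \<epsilon>\<^sup>2" by simp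
  have y2: "\<bar>exp (\<epsilon> * s) - (1 + \<epsilon> * s)\<bar> \<le> (\<epsilon> * s)\<^sup>2"
    using exp_bound[OF \<epsilon>s0 \<epsilon>s] exp_ge_add_one_self[of "\<epsilon> * s"] by simp
  have "\<epsilon> * \<bar>s - L\<bar> \<le> \<epsilon> * (\<epsilon> * (2 * l + 1 + 6 * \<rho>))" using sL \<epsilon>0 by (intro mult_left_mono) auto
  then have y3: "\<bar>\<epsilon> * s - \<epsilon> * L\<bar> \<le> \<epsilon>\<^sup>2 * (2 * l + 1 + 6 * \<rho>)"
    using \<epsilon>0 by (simp add: power2_eq_square abs_mult mult.assoc flip: right_diff_distrib)
  have "(\<epsilon> * s)\<^sup>2 \<le> (\<epsilon> * (2 * l))\<^sup>2" using s_2l s \<epsilon>0 by (intro power_mono mult_left_mono) auto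
  then have y2': "(\<epsilon> * s)\<^sup>2 \<le> \<epsilon>\<^sup>2 * (4 * l\<^sup>2)" by (simp add: power_mult_distrib)
  have target: "1 - \<epsilon> * ln \<epsilon> + \<epsilon> * ln (2 * r) = 1 + \<epsilon> * L" by (simp add: L_def l_def algebra_simps)
  have "\<bar>y - (1 + \<epsilon> * L)\<bar> \<le> 6 * \<epsilon>\<^sup>2 + \<epsilon>\<^sup>2 * (4 * l\<^sup>2) + \<epsilon>\<^sup>2 * (2 * l + 1 + 6 * \<rho>)"
    using y1 y2 y2' y3 by linarith
  also have "\<dots> = \<epsilon>\<^sup>2 * (4 * l\<^sup>2 + 2 * l + (7 + 6 * \<rho>) * 1)" by (simp add: algebra_simps)
  also have "\<dots> \<le> \<epsilon>\<^sup>2 * (4 * l\<^sup>2 + 2 * l\<^sup>2 + (7 + 6 * \<rho>) * l\<^sup>2)"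
    using l1 \<rho> by (intro mult_left_mono add_mono) (auto simp: self_le_power)
  also have "\<dots> \<le> (14 + 6 * \<rho>) * (\<epsilon>\<^sup>2 * l\<^sup>2)" by (simp add: algebra_simps)
  finally show ?thesis unfolding target by (simp add: l_def)
qed

section \<open>The graph\<close>

theorem lemma2p16:
  fixes \<rho> :: real
  assumes "\<rho> > 1"
  shows "\<exists>C \<epsilon>\<^sub>0. \<epsilon>\<^sub>0 > 0 \<and> (\<forall>\<epsilon>. 0 < \<epsilon> \<and> \<epsilon> < \<epsilon>\<^sub>0 \<longrightarrow>
    (\<exists>g :: real \<Rightarrow> real \<Rightarrow> real.
       horizontal_catenoid \<epsilon>
         \<inter> {(x, y, z). y \<ge> 1 \<and> inverse \<rho> \<le> sqrt (x\<^sup>2 + z\<^sup>2) \<and> sqrt (x\<^sup>2 + z\<^sup>2) \<le> \<rho>}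
       = {(x, g x z, z) | x z. inverse \<rho> \<le> sqrt (x\<^sup>2 + z\<^sup>2) \<and> sqrt (x\<^sup>2 + z\<^sup>2) \<le> \<rho>}
     \<and> (\<forall>r \<gamma>. inverse \<rho> \<le> r \<and> r \<le> \<rho> \<longrightarrow>
          \<bar>g (r * sin \<gamma>) (r * cos \<gamma>) - (1 - \<epsilon> * ln \<epsilon> + \<epsilon> * ln (2 * r))\<bar>
            \<le> C * (\<epsilon>\<^sup>2 * (ln \<epsilon>)\<^sup>2))))"
proof (rule exI[of _ "14 + 6 * \<rho>"], rule exI[of _ "1 / (4 * \<rho> * exp 1)"], intro conjI allI impI)
  show "0 < 1 / (4 * \<rho> * exp 1)" using assms by simp
next
  fix \<epsilon> :: real
  assume "0 < \<epsilon> \<and> \<epsilon> < 1 / (4 * \<rho> * exp 1)"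
  then have \<epsilon>0: "0 < \<epsilon>" and small: "\<epsilon> * (4 * \<rho> * exp 1) \<le> 1"
    using assms by (simp_all add: field_simps)
  have e2: "2 \<le> exp (1::real)" using exp_ge_add_one_self[of 1] by simp
  have \<rho>\<epsilon>: "8 * \<rho> * \<epsilon> \<le> 1"
  proof -
    have "\<epsilon> * (4 * \<rho> * 2) \<le> \<epsilon> * (4 * \<rho> * exp 1)" using e2 assms \<epsilon>0 by (intro mult_left_mono) auto
    also have "\<dots> \<le> 1" by (rule small)
    finally show ?thesis by (simp add: mult_ac)
  qed
  have "8 * 1 * \<epsilon> \<le> 8 * \<rho> * \<epsilon>" using assms \<epsilon>0 by (intro mult_right_mono) auto
  then have \<epsilon>8: "\<epsilon> \<le> 1/8" using \<rho>\<epsilon> by simp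
  define \<alpha> where "\<alpha> = alpha_of_eps \<epsilon>"
  have \<alpha>0: "0 < \<alpha>" using \<epsilon>0 by (simp add: \<alpha>_def alpha_of_eps_eq)
  have eps: "eps_of_alpha \<alpha> = \<epsilon>"
    using eps_of_alpha_eq_iff[OF \<alpha>0 \<epsilon>0] alpha_of_eps_eq[OF \<epsilon>0] by (simp add: \<alpha>_def)
  have \<alpha>sq: "8 * \<rho> \<le> 3 * \<alpha>\<^sup>2"
  proof -
    have rel: "\<alpha>\<^sup>2 * (\<epsilon> * (\<epsilon> + 2)) = 1" using eps_alpha_relation[OF \<alpha>0] eps by simp
    have "8 * \<rho> * \<epsilon> * (\<epsilon> + 2) \<le> 1 * 3" using \<rho>\<epsilon> \<epsilon>8 \<epsilon>0 assms by (intro mult_mono) auto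
    then have "\<alpha>\<^sup>2 * (8 * \<rho> * \<epsilon> * (\<epsilon> + 2)) \<le> \<alpha>\<^sup>2 * 3" by (intro mult_left_mono) auto
    moreover have "\<alpha>\<^sup>2 * (8 * \<rho> * \<epsilon> * (\<epsilon> + 2)) = 8 * \<rho> * (\<alpha>\<^sup>2 * (\<epsilon> * (\<epsilon> + 2)))" by simp
    ultimately show ?thesis using rel assms by simp
  qed
  have "1\<^sup>2 \<le> \<alpha>\<^sup>2" using \<alpha>sq assms by simp
  then have \<alpha>1: "1 \<le> \<alpha>" using \<alpha>0 by (simp only: power2_le_iff_abs_le abs_of_pos abs_one)
  \<comment> \<open>\<open>lift x z y\<close>: a point over \<open>(x, z)\<close> in the half \<open>s \<ge> 0\<close> of the catenoid has height \<open>y\<close>\<close>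
  define lift where "lift x z y \<longleftrightarrow> (\<exists>s \<theta>. 0 \<le> s \<and> catenoid_param \<alpha> (s, \<theta>) = (x, y, z))" for x z y
  define g where "g x z = (THE y. lift x z y)" for x z
  have g_eq: "g x z = y" if "lift x z y" for x y z
    unfolding g_def using that height_determined[OF \<alpha>1]
    by (intro the_equality) (auto simp: lift_def)
  have g: "lift x z (g x z)" "1 \<le> g x z" if r: "inverse \<rho> \<le> sqrt (x\<^sup>2 + z\<^sup>2)" for x z
  proof -
    have A: "\<alpha> < alpha_star \<alpha>" by (rule alpha_less_alpha_star[OF \<alpha>0])
    have "inverse \<rho> \<le> \<bar>x\<bar> + \<bar>z\<bar>" using r sqrt_sum_squares_le_sum_abs[of x z] by linarith
    then consider "inverse (2 * \<rho>) \<le> \<bar>z\<bar>" | "inverse (2 * \<rho>) \<le> \<bar>x\<bar>"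
      by (force simp: inverse_mult_distrib)
    moreover have big: "2 * \<rho> \<le> \<alpha> * (\<alpha> + alpha_star \<alpha>)" "2 * \<rho> \<le> alpha_star \<alpha> * \<alpha>"
    proof -
      have "8 * \<rho> \<le> 3 * \<alpha>\<^sup>2" using \<alpha>sq by simp
      moreover have "\<alpha>\<^sup>2 \<le> alpha_star \<alpha> * \<alpha>" using A \<alpha>0 by (simp add: power2_eq_square)
      moreover have "\<alpha> * \<alpha> \<le> \<alpha> * alpha_star \<alpha>" using A \<alpha>0 by simp
      ultimately show "2 * \<rho> \<le> \<alpha> * (\<alpha> + alpha_star \<alpha>)" "2 * \<rho> \<le> alpha_star \<alpha> * \<alpha>"
        using assms by (auto simp: power2_eq_square algebra_simps)
    qed
    ultimately have "1 \<le> \<bar>z\<bar> * (\<alpha> * (\<alpha> + alpha_star \<alpha>)) \<or> 1 \<le> \<bar>x\<bar> * (alpha_star \<alpha> * \<alpha>)"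
    proof cases
      case 1
      then have "inverse (2 * \<rho>) * (2 * \<rho>) \<le> \<bar>z\<bar> * (\<alpha> * (\<alpha> + alpha_star \<alpha>))"
        by (rule mult_mono) (use big assms in auto)
      then show ?thesis using assms by simp
    next
      case 2
      then have "inverse (2 * \<rho>) * (2 * \<rho>) \<le> \<bar>x\<bar> * (alpha_star \<alpha> * \<alpha>)"
        by (rule mult_mono) (use big assms in auto)
      then show ?thesis using assms by simp
    qed
    then obtain s \<theta> y where p: "0 \<le> s" "catenoid_param \<alpha> (s, \<theta>) = (x, y, z)"
      using exists_param[OF \<alpha>1] by blast
    then have l: "lift x z y" by (auto simp: lift_def)
    have "2 * exp 1 * \<epsilon> \<le> inverse \<rho>" using small \<epsilon>0 assms by (simp add: field_simps)
    then have "1 \<le> y" using height_ge_1[OF \<alpha>0 p] eps \<epsilon>8 r by simp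
    then show "lift x z (g x z)" "1 \<le> g x z" using l g_eq[OF l] by simp_all
  qed
  show "\<exists>g :: real \<Rightarrow> real \<Rightarrow> real.
       horizontal_catenoid \<epsilon>
         \<inter> {(x, y, z). y \<ge> 1 \<and> inverse \<rho> \<le> sqrt (x\<^sup>2 + z\<^sup>2) \<and> sqrt (x\<^sup>2 + z\<^sup>2) \<le> \<rho>}
       = {(x, g x z, z) | x z. inverse \<rho> \<le> sqrt (x\<^sup>2 + z\<^sup>2) \<and> sqrt (x\<^sup>2 + z\<^sup>2) \<le> \<rho>}
     \<and> (\<forall>r \<gamma>. inverse \<rho> \<le> r \<and> r \<le> \<rho> \<longrightarrow>
          \<bar>g (r * sin \<gamma>) (r * cos \<gamma>) - (1 - \<epsilon> * ln \<epsilon> + \<epsilon> * ln (2 * r))\<bar>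
            \<le> (14 + 6 * \<rho>) * (\<epsilon>\<^sup>2 * (ln \<epsilon>)\<^sup>2))"
  proof (intro exI[of _ g] conjI allI impI)
    have height: "y = g x z" if "(x, y, z) \<in> horizontal_catenoid \<epsilon>" "1 \<le> y" for x y z
    proof -
      have "(x, y, z) \<in> range (catenoid_param \<alpha>)"
        using that(1) by (simp only: horizontal_catenoid_def \<alpha>_def)
      then obtain q where "(x, y, z) = catenoid_param \<alpha> q" by (rule rangeE)
      then obtain s \<theta> where p: "catenoid_param \<alpha> (s, \<theta>) = (x, y, z)" by (cases q) simp
      then have "lift x z y" using height_ge_1_imp_nonneg[OF \<alpha>0 p that(2)] by (auto simp: lift_def)
      then show ?thesis using g_eq by simp
    qed
    have on_catenoid: "(x, g x z, z) \<in> horizontal_catenoid \<epsilon>"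
      if r: "inverse \<rho> \<le> sqrt (x\<^sup>2 + z\<^sup>2)" for x z
    proof -
      obtain s \<theta> where p: "catenoid_param \<alpha> (s, \<theta>) = (x, g x z, z)"
        using g(1)[OF r] unfolding lift_def by blast
      show ?thesis
        unfolding horizontal_catenoid_def \<alpha>_def[symmetric]
        using rangeI[of "catenoid_param \<alpha>" "(s, \<theta>)"] by (simp only: p)
    qed
    show "horizontal_catenoid \<epsilon>
         \<inter> {(x, y, z). y \<ge> 1 \<and> inverse \<rho> \<le> sqrt (x\<^sup>2 + z\<^sup>2) \<and> sqrt (x\<^sup>2 + z\<^sup>2) \<le> \<rho>}
       = {(x, g x z, z) | x z. inverse \<rho> \<le> sqrt (x\<^sup>2 + z\<^sup>2) \<and> sqrt (x\<^sup>2 + z\<^sup>2) \<le> \<rho>}" (is "?L = ?R")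
    proof
      show "?L \<subseteq> ?R" using height by blast
      show "?R \<subseteq> ?L" using on_catenoid g(2) by auto
    qed
  next
    fix r \<gamma> :: real
    assume r: "inverse \<rho> \<le> r \<and> r \<le> \<rho>"
    have "0 < inverse \<rho>" using assms by simp
    then have r0: "0 < r" using r by linarith
    have "(r * sin \<gamma>)\<^sup>2 + (r * cos \<gamma>)\<^sup>2 = r\<^sup>2"
      by (simp add: power_mult_distrib flip: distrib_left)
    then have polar: "sqrt ((r * sin \<gamma>)\<^sup>2 + (r * cos \<gamma>)\<^sup>2) = r" using r0 by simp
    obtain s \<theta> where p: "0 \<le> s"
        "catenoid_param \<alpha> (s, \<theta>) = (r * sin \<gamma>, g (r * sin \<gamma>) (r * cos \<gamma>), r * cos \<gamma>)"
      using g(1)[of "r * sin \<gamma>" "r * cos \<gamma>"] r polar by (auto simp: lift_def)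
    have "\<epsilon> * (2 * \<rho> * exp 1) \<le> \<epsilon> * (4 * \<rho> * exp 1)" using \<epsilon>0 assms by simp
    then show "\<bar>g (r * sin \<gamma>) (r * cos \<gamma>) - (1 - \<epsilon> * ln \<epsilon> + \<epsilon> * ln (2 * r))\<bar>
            \<le> (14 + 6 * \<rho>) * (\<epsilon>\<^sup>2 * (ln \<epsilon>)\<^sup>2)"
      using height_expansion[OF assms \<alpha>0 p g(2)] small r by (simp only: polar eps)
  qed
qed

end
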